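(* In general, the two measure-dimension mappings $\dim_C$ and $\dim_{MC}$ on $\mathcal{M}(X)$ are neither upper semi-continuous nor lower semi-continuous under the TV topology. That is, for each $D\in\{\dim_C,\dim_{MC}\}$: (i) there exist a metric space $X$ and measures $\nu_n,\nu\in\mathcal{M}(X)$ at which $D$ is defined, with $\|\nu_n-\nu\|_{TV}\to0$ and $\limsup_{n\to\infty}D(\nu_n)>D(\nu)$; and (ii) there exist a metric space $X$ and measures $\nu_n,\nu\in\mathcal{M}(X)$ at which $D$ is defined, with $\|\nu_n-\nu\|_{TV}\to0$ and $\liminf_{n\to\infty}D(\nu_n)<D(\nu)$.
   Context: For a metric space $(X,\rho)$, $\mathcal{B}$ is its Borel $\sigma$-algebra, $\mathcal{M}(X)$ the collection of all Borel measures on $X$, and $B(x,r)$ the ball of radius $r$ about $x$. The correlation dimension of $\nu\in\mathcal{M}(X)$ is $\dim_C(\nu)=\lim_{r\to0}\frac{\log\int\nu(B(x,r))\,d\nu(x)}{\log r}$, when the limit exists. The modified correlation dimension is $\dim_{MC}(\nu)=\lim_{\delta\to0}\ \sup_{\{A\in\mathcal{B}:\ \nu(A)\ge1-\delta\}}\ \lim_{r\to0}\frac{\log\int_A\nu(B(x,r))\,d\nu(x)}{\log r}$, when the limit exists. The TV topology is induced by $\|\nu-\varrho\|_{TV}=\sup_{A\in\mathcal{B}}|\nu(A)-\varrho(A)|$.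
   Formalization: In dim_MC the supremum is taken only over those A with ν(A) ≥ 1-δ whose inner limit exists; if every such A must have an inner limit, dim_MC is upper semi-continuous on finite measures (separable X), so claim (i) for dim_MC would be false. *)

theory Defs
  imports "HOL-Analysis.Analysis"
begin

definition borel_sets :: "'a metric \<Rightarrow> 'a set set" where
  "borel_sets X = sigma_sets (mspace X) {U. openin (mtopology_of X) U}"

text \<open>All Borel measures on X: neither normalised nor required to be finite.\<close>

definition borel_measures :: "'a metric \<Rightarrow> 'a measure set" where
  "borel_measures X = {\<nu>. space \<nu> = mspace X \<and> sets \<nu> = borel_sets X}"

text \<open>The difference is taken in the extended reals, where \<open>\<infinity> - \<infinity> = \<infinity>\<close>;
  hence the distance is infinite as soon as one of the two measures is infinite, and
  convergence in this distance only happens between (eventually) finite measures.\<close>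

definition tv_dist :: "'a metric \<Rightarrow> 'a measure \<Rightarrow> 'a measure \<Rightarrow> ereal" where
  "tv_dist X \<nu> \<rho> = (SUP A\<in>borel_sets X. \<bar>enn2ereal (emeasure \<nu> A) - enn2ereal (emeasure \<rho> A)\<bar>)"

definition corr_integral :: "'a metric \<Rightarrow> 'a measure \<Rightarrow> 'a set \<Rightarrow> real \<Rightarrow> ennreal" where
  "corr_integral X \<nu> A r = (\<integral>\<^sup>+x\<in>A. emeasure \<nu> (mball_of X x r) \<partial>\<nu>)"

text \<open>The limit as the argument decreases to 0, as a partial value:
  \<open>None\<close> if there is no limit in the extended reals.\<close>

definition lim0 :: "(real \<Rightarrow> ereal) \<Rightarrow> ereal option" where
  "lim0 f = (if \<exists>L. (f \<longlongrightarrow> L) (at_right 0) then Some (Lim (at_right 0) f) else None)"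

text \<open>The limit of \<open>log (\<integral>\<^sub>A \<nu>(B(x,r)) d\<nu>(x)) / log r\<close>.  The logarithm is meaningful only if the
  integral is positive and finite, and no convention for \<open>log 0\<close> or \<open>log \<infinity>\<close> is used: otherwise
  (e.g. for the zero measure or a null set A) the limit does not exist.\<close>

definition corr_exponent :: "'a metric \<Rightarrow> 'a measure \<Rightarrow> 'a set \<Rightarrow> ereal option" where
  "corr_exponent X \<nu> A =
     (if \<forall>\<^sub>F r in at_right 0. 0 < corr_integral X \<nu> A r \<and> corr_integral X \<nu> A r < \<infinity>
      then lim0 (\<lambda>r. ereal (ln (enn2real (corr_integral X \<nu> A r)) / ln r)) else None)"

definition dim_C :: "'a metric \<Rightarrow> 'a measure \<Rightarrow> ereal option" where
  "dim_C X \<nu> = corr_exponent X \<nu> (mspace X)"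

text \<open>The values over which the supremum in the modified correlation dimension is taken:
  the inner limits along those Borel sets A with \<open>\<nu>(A) \<ge> 1 - \<delta>\<close> for which this limit exists.\<close>

definition MC_exponents :: "'a metric \<Rightarrow> 'a measure \<Rightarrow> real \<Rightarrow> ereal set" where
  "MC_exponents X \<nu> \<delta> =
     {L. \<exists>A\<in>borel_sets X. ennreal (1 - \<delta>) \<le> emeasure \<nu> A \<and> corr_exponent X \<nu> A = Some L}"

text \<open>The supremum of the empty set is not counted as a value, so the dimension is undefined
  if for some \<open>\<delta> > 0\<close> there is no such set A (in particular if the total mass is less than 1).\<close>

definition dim_MC :: "'a metric \<Rightarrow> 'a measure \<Rightarrow> ereal option" where
  "dim_MC X \<nu> =
     (if \<forall>\<delta>>0. MC_exponents X \<nu> \<delta> \<noteq> {} then lim0 (\<lambda>\<delta>. Sup (MC_exponents X \<nu> \<delta>)) else None)"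

end

theory Submission
  imports Defs "HOL-Real_Asymp.Real_Asymp"
begin

text \<open>
  Both dimensions depend on a measure through arbitrarily small pieces of it, whereas the total
  variation distance does not see small pieces. All four counterexamples live on one metric space
  \<open>osc_line\<close>: the real line with a metric that induces the usual topology, is the usual distance on
  \<open>[0,\<infinity>)\<close>, and is distorted on the negative half-line.  All measures are push-forwards of Lebesgue
  measure on a bounded set E under a fixed map, so that moving E by a set of small Lebesgue measure
  moves the push-forward by as little in total variation.

  \<^item> Lower semi-continuity fails for both dimensions because an atom of mass \<open>e\<close>, however small,
    forces the value 0: the correlation integral is then at least \<open>e\<^sup>2\<close> at every scale, and a set of
    mass at least \<open>1 - \<delta>\<close> contains the atom once \<open>\<delta> < e\<close>.  The limit is uniform measure on \<open>[0,1]\<close>,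
    of dimension 1.

  \<^item> Upper semi-continuity fails for \<open>dim_C\<close> because mass that is concentrated at a point extremely
    slowly can be cut off.  The image of uniform measure on \<open>(0,1]\<close> under \<open>x \<mapsto> exp (-1/x)\<close> gives mass
    \<open>1 / ln (1/r)\<close> to \<open>(0,r]\<close>, so its correlation integral decays only logarithmically and its
    dimension is 0.  On \<open>[e,1]\<close> the map is bi-Lipschitz, so the image of that interval has dimension 1.

  \<^item> Upper semi-continuity of \<open>dim_MC\<close> fails through the existence of the inner limit.  Removing
    a small set makes lower bounds on the exponent stable under small perturbations, so that only sets
    A without exponent can be responsible for a drop.  On \<open>[-1,0]\<close> the metric is such that balls
    around every point have Lebesgue measure about \<open>r\<^sup>3\<close> at some scales and about \<open>r\<^sup>2\<close> at others.
    Hence no set of positive measure in \<open>[-1,0]\<close> has an exponent.  Lebesgue measure on \<open>[-1,0]\<close>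
    together with an atom of mass 1 therefore has \<open>dim_MC\<close> equal to 0, since only the sets
    through the atom are counted.  Enlarging \<open>[-1,0]\<close> to \<open>[-1,e]\<close> adds a piece of exponent 1 which
    dominates the oscillating one, so that the part without the atom acquires exponent 1.  Its mass
    is at least 1, hence it counts for every \<open>\<delta>\<close>.
\<close>

section \<open>A gauge oscillating between two powers\<close>

definition osc_radius :: "nat \<Rightarrow> real" where
  "osc_radius k = (1/2) ^ (4 ^ k)"

text \<open>A supremum of functions that are linear up to \<open>(osc_radius k)\<^sup>3\<close> and then constant, hence
  subadditive.  Its graph touches \<open>t powr (1/3)\<close> at every \<open>(osc_radius k)\<^sup>3\<close> but is as low as
  \<open>sqrt t\<close> at every \<open>osc_radius (Suc k)\<close>.\<close>

definition osc_gauge :: "real \<Rightarrow> real" where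
  "osc_gauge t = (SUP k. min (osc_radius k) (t / (osc_radius k)\<^sup>2))"

text \<open>Clamping to the negative half-line confines the distortion to it; taking the maximum with the
  usual distance keeps this a metric without any condition on points of different sign.\<close>

definition osc_dist :: "real \<Rightarrow> real \<Rightarrow> real" where
  "osc_dist x y = max \<bar>x - y\<bar> (osc_gauge \<bar>min x 0 - min y 0\<bar>)"

definition osc_line :: "real metric" where
  "osc_line = metric (UNIV, osc_dist)"

lemma osc_radius_pos [simp]: "0 < osc_radius k"
  by (simp add: osc_radius_def)

lemma osc_radius_le_half: "osc_radius k \<le> 1/2"
  unfolding osc_radius_def using power_decreasing[of 1 "4^k" "1/2::real"] by simp

lemma osc_radius_Suc: "osc_radius (Suc k) = osc_radius k ^ 4"
  unfolding osc_radius_def power_mult[symmetric] by (simp add: mult.commute)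

lemma osc_radius_antimono: "j \<le> k \<Longrightarrow> osc_radius k \<le> osc_radius j"
  unfolding osc_radius_def by (intro power_decreasing power_increasing) auto

lemma osc_radius_tendsto: "filterlim osc_radius (at_right 0) sequentially"
proof -
  have "osc_radius \<longlonglongrightarrow> 0"
    unfolding osc_radius_def by real_asymp
  then show ?thesis
    by (simp add: filterlim_at osc_radius_pos[THEN less_imp_neq[THEN not_sym]])
qed

lemma osc_gauge_bdd: "bdd_above (range (\<lambda>k. min (osc_radius k) (t / (osc_radius k)\<^sup>2)))"
  by (rule bdd_aboveI2[of _ _ "1/2"]) (use osc_radius_le_half min.coboundedI1 in blast)

lemma osc_gauge_upper: "min (osc_radius k) (t / (osc_radius k)\<^sup>2) \<le> osc_gauge t"
  unfolding osc_gauge_def by (rule cSUP_upper[OF _ osc_gauge_bdd]) simp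

lemma osc_gauge_least:
  "(\<And>k. min (osc_radius k) (t / (osc_radius k)\<^sup>2) \<le> b) \<Longrightarrow> osc_gauge t \<le> b"
  unfolding osc_gauge_def by (rule cSUP_least) auto

lemma osc_gauge_nonneg: "0 \<le> t \<Longrightarrow> 0 \<le> osc_gauge t"
  using osc_gauge_upper[of 0 t] osc_radius_pos[of 0]
  by (smt (verit) divide_nonneg_nonneg min_def zero_le_power2)

lemma osc_gauge_zero [simp]: "osc_gauge 0 = 0"
proof -
  have "osc_gauge 0 \<le> 0" by (rule osc_gauge_least) auto
  then show ?thesis using osc_gauge_nonneg[of 0] by simp
qed

lemma osc_gauge_subadditive:
  assumes "0 \<le> s" "0 \<le> t" "u \<le> s + t"
  shows "osc_gauge u \<le> osc_gauge s + osc_gauge t"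
proof (rule osc_gauge_least)
  fix k
  define a where "a = osc_radius k"
  have a: "a > 0" by (simp add: a_def)
  have "u / a\<^sup>2 \<le> s / a\<^sup>2 + t / a\<^sup>2" "0 \<le> s / a\<^sup>2" "0 \<le> t / a\<^sup>2"
    using assms a by (auto simp: divide_simps)
  then have "min a (u / a\<^sup>2) \<le> min a (s / a\<^sup>2) + min a (t / a\<^sup>2)"
    using a by linarith
  also have "\<dots> \<le> osc_gauge s + osc_gauge t"
    unfolding a_def by (intro add_mono osc_gauge_upper)
  finally show "min (osc_radius k) (u / (osc_radius k)\<^sup>2) \<le> osc_gauge s + osc_gauge t"
    by (simp add: a_def)
qed

lemma osc_gauge_le_of_le_cube:
  assumes "0 \<le> r" "t \<le> r ^ 3"
  shows "osc_gauge t \<le> r"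
proof (rule osc_gauge_least)
  fix k
  define a where "a = osc_radius k"
  have a: "a > 0" by (simp add: a_def)
  have "min a (t / a\<^sup>2) \<le> r"
  proof (cases "a \<le> r")
    case False
    then have "r ^ 3 \<le> r * a\<^sup>2"
      using assms(1) mult_left_mono[OF power_mono[of r a 2], of r]
      by (simp add: power3_eq_cube power2_eq_square mult.assoc)
    then have "t / a\<^sup>2 \<le> r"
      using assms(2) a by (simp add: pos_divide_le_eq)
    then show ?thesis by simp
  qed simp
  then show "min (osc_radius k) (t / (osc_radius k)\<^sup>2) \<le> r"
    by (simp add: a_def)
qed

lemma less_cube_of_osc_gauge_less:
  assumes "osc_gauge t < osc_radius k"
  shows "t < osc_radius k ^ 3"
proof (rule ccontr)
  assume "\<not> t < osc_radius k ^ 3"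
  then have "osc_radius k \<le> t / (osc_radius k)\<^sup>2"
    by (simp add: pos_le_divide_eq power2_eq_square power3_eq_cube)
  then show False
    using osc_gauge_upper[of k t] assms by simp
qed

text \<open>In this form the second regime is visible: the pieces with index above k are too small, and those
  up to k are still in their linear part.\<close>

lemma osc_gauge_le_square:
  assumes "0 \<le> t" "t \<le> osc_radius k ^ 4"
  shows "osc_gauge t \<le> (osc_radius k)\<^sup>2"
proof (rule osc_gauge_least)
  fix j
  define a where "a = osc_radius k"
  define b where "b = osc_radius j"
  have a: "0 < a" "a \<le> 1" and b: "0 < b"
    using osc_radius_le_half[of k] by (auto simp: a_def b_def)
  have "min b (t / b\<^sup>2) \<le> a\<^sup>2"
  proof (cases "j \<le> k")
    case True
    then have "a \<le> b"
      using osc_radius_antimono by (simp add: a_def b_def)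
    then have "a ^ 2 * a ^ 2 \<le> a ^ 2 * b ^ 2"
      using a by (intro mult_left_mono power_mono) auto
    then have "t / b\<^sup>2 \<le> a\<^sup>2"
      using assms(2) b by (simp add: pos_divide_le_eq a_def[symmetric] power_add[symmetric])
    then show ?thesis by simp
  next
    case False
    then have "b \<le> osc_radius (Suc k)"
      using osc_radius_antimono[of "Suc k" j] by (simp add: b_def)
    also have "\<dots> \<le> a\<^sup>2"
      unfolding osc_radius_Suc a_def[symmetric] using a by (intro power_decreasing) auto
    finally show ?thesis by simp
  qed
  then show "min (osc_radius j) (t / (osc_radius j)\<^sup>2) \<le> (osc_radius k)\<^sup>2"
    by (simp add: a_def b_def)
qed

section \<open>The distorted line\<close>

lemma Metric_space_osc_dist: "Metric_space UNIV osc_dist"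
proof
  fix x y z :: real
  show "0 \<le> osc_dist x y" "osc_dist x y = osc_dist y x"
    by (auto simp: osc_dist_def abs_minus_commute)
  show "osc_dist x y = 0 \<longleftrightarrow> x = y"
    by (auto simp: osc_dist_def max_def split: if_splits)
  have "osc_gauge \<bar>min x 0 - min z 0\<bar> \<le> osc_gauge \<bar>min x 0 - min y 0\<bar> + osc_gauge \<bar>min y 0 - min z 0\<bar>"
    by (rule osc_gauge_subadditive)
      (use dist_triangle[of "min x 0" "min z 0" "min y 0"] in \<open>auto simp: dist_real_def\<close>)
  moreover have "\<bar>x - z\<bar> \<le> \<bar>x - y\<bar> + \<bar>y - z\<bar>"
    by simp
  ultimately show "osc_dist x z \<le> osc_dist x y + osc_dist y z"
    unfolding osc_dist_def
    by (intro max.boundedI) (erule order_trans, intro add_mono max.cobounded1 max.cobounded2)+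
qed

interpretation osc: Metric_space UNIV osc_dist
  by (rule Metric_space_osc_dist)

lemma mspace_osc_line [simp]: "mspace osc_line = UNIV"
  by (simp add: osc_line_def)

lemma mball_osc_line: "mball_of osc_line x r = {y. osc_dist x y < r}"
  by (auto simp: osc_line_def mball_of_def osc.mball_def)

text \<open>The usual distance is at most \<open>osc_dist\<close>, which in turn is at most the maximum of the usual
  distance and its cube root.\<close>

lemma openin_osc_line: "openin (mtopology_of osc_line) U \<longleftrightarrow> open U"
proof
  have top: "mtopology_of osc_line = osc.mtopology"
    by (simp add: osc_line_def mtopology_of_def)
  assume U: "openin (mtopology_of osc_line) U"
  show "open U"
    unfolding open_dist
  proof
    fix x assume "x \<in> U"
    then obtain r where r: "0 < r" "osc.mball x r \<subseteq> U"
      using U by (auto simp: top osc.openin_mtopology)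
    define e where "e = min r (min 1 r ^ 3)"
    have "y \<in> U" if "dist y x < e" for y
    proof -
      define q where "q = root 3 \<bar>x - y\<bar>"
      have q: "0 \<le> q" "q ^ 3 = \<bar>x - y\<bar>"
        by (auto simp: q_def odd_real_root_pow)
      have "\<bar>x - y\<bar> < r" "q ^ 3 < min 1 r ^ 3"
        using that q by (auto simp: e_def dist_real_def)
      then have "q < r"
        using power_less_imp_less_base[of q 3 "min 1 r"] r by auto
      moreover have "osc_gauge \<bar>min x 0 - min y 0\<bar> \<le> q"
        using q by (intro osc_gauge_le_of_le_cube) auto
      ultimately have "osc_dist x y < r"
        using \<open>\<bar>x - y\<bar> < r\<close> by (simp add: osc_dist_def)
      then show "y \<in> U"
        using r by (auto simp: osc.mball_def)
    qed
    moreover have "e > 0" using r by (simp add: e_def)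
    ultimately show "\<exists>e>0. \<forall>y. dist y x < e \<longrightarrow> y \<in> U" by blast
  qed
next
  have top: "mtopology_of osc_line = osc.mtopology"
    by (simp add: osc_line_def mtopology_of_def)
  assume U: "open U"
  show "openin (mtopology_of osc_line) U"
    unfolding top osc.openin_mtopology
  proof (intro conjI ballI allI impI)
    fix x assume "x \<in> U"
    then obtain e where e: "e > 0" "\<And>y. dist y x < e \<Longrightarrow> y \<in> U"
      using U by (auto simp: open_dist)
    have "osc.mball x e \<subseteq> U"
      using e by (auto simp: osc.mball_def osc_dist_def dist_real_def abs_minus_commute)
    then show "\<exists>r>0. osc.mball x r \<subseteq> U" using e by blast
  qed simp
qed

lemma borel_sets_osc_line: "borel_sets osc_line = sets borel"
  by (simp add: borel_sets_def openin_osc_line borel_def)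

lemma mball_osc_line_borel [measurable]: "mball_of osc_line x r \<in> sets borel"
proof -
  have "openin (mtopology_of osc_line) (mball_of osc_line x r)"
    by (simp add: osc_line_def mtopology_of_def)
  then show ?thesis by (simp add: openin_osc_line)
qed

section \<open>Push-forwards of Lebesgue measure\<close>

definition law :: "(real \<Rightarrow> real) \<Rightarrow> real set \<Rightarrow> real measure" where
  "law c E = distr (restrict_space lborel E) borel c"

lemma space_law [simp]: "space (law c E) = UNIV"
  and sets_law [simp, measurable_cong]: "sets (law c E) = sets borel"
  by (auto simp: law_def)

lemma law_in_borel_measures: "law c E \<in> borel_measures osc_line"
  by (simp add: borel_measures_def borel_sets_osc_line)

lemma emeasure_law:
  assumes [measurable]: "c \<in> borel_measurable borel" "E \<in> sets borel" "A \<in> sets borel"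
  shows "emeasure (law c E) A = emeasure lborel (E \<inter> c -` A)"
proof -
  have "c \<in> restrict_space lborel E \<rightarrow>\<^sub>M borel"
    by (rule measurable_restrict_space1) simp
  then have "emeasure (law c E) A = emeasure (restrict_space lborel E) (c -` A \<inter> E)"
    by (simp add: law_def emeasure_distr space_restrict_space)
  also have "\<dots> = emeasure lborel (E \<inter> c -` A)"
    by (subst emeasure_restrict_space) (auto simp: Int_commute)
  finally show ?thesis .
qed

lemma tv_dist_law_le:
  assumes [measurable]: "c \<in> borel_measurable borel" "E \<in> sets borel" "F \<in> sets borel"
    and fin: "emeasure lborel E < \<infinity>" "emeasure lborel F < \<infinity>"
    and EF: "emeasure lborel (E - F) \<le> ennreal e" and FE: "emeasure lborel (F - E) \<le> ennreal e"
    and e: "0 \<le> e"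
  shows "tv_dist osc_line (law c E) (law c F) \<le> ereal e"
proof -
  have one: "emeasure (law c G) A \<le> emeasure (law c H) A + ennreal e"
    if [measurable]: "G \<in> sets borel" "H \<in> sets borel" "A \<in> sets borel"
      and GH: "emeasure lborel (G - H) \<le> ennreal e" for G H A
  proof -
    have "emeasure lborel (G \<inter> c -` A) \<le> emeasure lborel ((H \<inter> c -` A) \<union> (G - H))"
      by (rule emeasure_mono) (auto intro: measurable_sets_borel)
    also have "\<dots> \<le> emeasure lborel (H \<inter> c -` A) + emeasure lborel (G - H)"
      by (rule emeasure_subadditive) (auto intro: measurable_sets_borel)
    also have "\<dots> \<le> emeasure lborel (H \<inter> c -` A) + ennreal e"
      using GH by (rule add_left_mono)
    finally show ?thesis by (simp add: emeasure_law)
  qed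
  have fn: "\<exists>m\<ge>0. emeasure (law c G) A = ennreal m"
    if [measurable]: "G \<in> sets borel" "A \<in> sets borel" and "emeasure lborel G < \<infinity>" for G A
  proof -
    have "emeasure lborel (G \<inter> c -` A) \<le> emeasure lborel G"
      by (rule emeasure_mono) auto
    then show ?thesis using that(3)
      by (simp add: emeasure_law) (metis ennreal_cases infinity_ennreal_def leD less_top)
  qed
  show ?thesis
    unfolding tv_dist_def borel_sets_osc_line
  proof (rule SUP_least)
    fix A :: "real set" assume A [measurable]: "A \<in> sets borel"
    obtain m where m: "m \<ge> 0" "emeasure (law c E) A = ennreal m" using fn[of E A] fin by auto
    obtain k where k: "k \<ge> 0" "emeasure (law c F) A = ennreal k" using fn[of F A] fin by auto
    have "m \<le> k + e" "k \<le> m + e"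
      using one[of E F A] one[of F E A] EF FE m k e
      by (auto simp: ennreal_plus[symmetric] simp del: ennreal_plus)
    then show "\<bar>enn2ereal (emeasure (law c E) A) - enn2ereal (emeasure (law c F) A)\<bar> \<le> ereal e"
      using m k by (simp add: enn2ereal_ennreal abs_le_iff)
  qed
qed

lemma tv_dist_law_tendsto:
  assumes "c \<in> borel_measurable borel" "F \<in> sets borel" "emeasure lborel F < \<infinity>"
    and "\<And>n. E n \<in> sets borel" "\<And>n. emeasure lborel (E n) < \<infinity>"
    and "\<And>n. emeasure lborel (E n - F) \<le> ennreal (e n)" "\<And>n. emeasure lborel (F - E n) \<le> ennreal (e n)"
    and "\<And>n. 0 \<le> e n" "e \<longlonglongrightarrow> 0"
  shows "(\<lambda>n. tv_dist osc_line (law c (E n)) (law c F)) \<longlonglongrightarrow> 0"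
proof (rule tendsto_sandwich)
  show "\<forall>\<^sub>F n in sequentially. 0 \<le> tv_dist osc_line (law c (E n)) (law c F)"
    unfolding tv_dist_def by (intro always_eventually allI SUP_upper2[of UNIV]) (auto simp: borel_sets_osc_line)
  show "\<forall>\<^sub>F n in sequentially. tv_dist osc_line (law c (E n)) (law c F) \<le> ereal (e n)"
    using assms by (intro always_eventually allI tv_dist_law_le) auto
  show "(\<lambda>n. ereal (e n)) \<longlonglongrightarrow> 0"
    using assms(9) by (simp add: zero_ereal_def)
qed simp


section \<open>Bounds on correlation integrals and their exponents\<close>

lemma corr_exponent_eqI:
  assumes ev: "\<forall>\<^sub>F r in at_right 0. 0 < lo r \<and> ennreal (lo r) \<le> corr_integral X \<nu> A r
      \<and> corr_integral X \<nu> A r \<le> ennreal (hi r)"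
    and lo: "((\<lambda>r. ln (lo r) / ln r) \<longlongrightarrow> s) (at_right 0)"
    and hi: "((\<lambda>r. ln (hi r) / ln r) \<longlongrightarrow> s) (at_right 0)"
  shows "corr_exponent X \<nu> A = Some (ereal s)"
proof -
  define J where "J r = enn2real (corr_integral X \<nu> A r)" for r
  have r1: "\<forall>\<^sub>F r in at_right 0. 0 < r \<and> r < (1::real)"
    by (auto simp: eventually_at_right_field intro: exI[of _ 1])
  have fin: "\<forall>\<^sub>F r in at_right 0. 0 < corr_integral X \<nu> A r \<and> corr_integral X \<nu> A r < \<infinity>"
    using ev
  proof eventually_elim
    case (elim r)
    then have "0 < ennreal (lo r)" by simp
    also have "\<dots> \<le> corr_integral X \<nu> A r" using elim by simp
    finally have "0 < corr_integral X \<nu> A r" .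
    moreover have "corr_integral X \<nu> A r < \<infinity>"
      using elim ennreal_less_top[of "hi r"] by (auto intro: le_less_trans)
    ultimately show ?case by simp
  qed
  have J: "\<forall>\<^sub>F r in at_right 0. 0 < lo r \<and> lo r \<le> J r \<and> J r \<le> hi r \<and> ln r < 0"
    using ev fin r1
  proof eventually_elim
    case (elim r)
    then have c: "corr_integral X \<nu> A r = ennreal (J r)" by (simp add: J_def)
    have "ennreal (lo r) \<le> ennreal (hi r)" using elim by (blast intro: order_trans)
    then have "0 \<le> hi r" using elim by (metis ennreal_le_iff2 less_imp_le linorder_not_le)
    then show ?case using elim unfolding c by (auto simp: J_def)
  qed
  have "((\<lambda>r. ln (J r) / ln r) \<longlongrightarrow> s) (at_right 0)"
  proof (rule tendsto_sandwich[OF _ _ hi lo])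
    show "\<forall>\<^sub>F r in at_right 0. ln (hi r) / ln r \<le> ln (J r) / ln r"
      using J by eventually_elim (auto intro!: divide_right_mono_neg)
    show "\<forall>\<^sub>F r in at_right 0. ln (J r) / ln r \<le> ln (lo r) / ln r"
      using J by eventually_elim (auto intro!: divide_right_mono_neg)
  qed
  then have lim: "((\<lambda>r. ereal (ln (J r) / ln r)) \<longlongrightarrow> ereal s) (at_right 0)"
    by (rule tendsto_ereal)
  then have "Lim (at_right 0) (\<lambda>r. ereal (ln (J r) / ln r)) = ereal s"
    by (intro tendsto_Lim) auto
  with lim fin show ?thesis
    unfolding corr_exponent_def lim0_def J_def by auto
qed

lemma corr_exponent_SomeD:
  assumes "corr_exponent X \<nu> A = Some L"
  shows "\<forall>\<^sub>F r in at_right 0. 0 < corr_integral X \<nu> A r \<and> corr_integral X \<nu> A r < \<infinity>"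
    and "((\<lambda>r. ereal (ln (enn2real (corr_integral X \<nu> A r)) / ln r)) \<longlongrightarrow> L) (at_right 0)"
proof -
  let ?f = "\<lambda>r. ereal (ln (enn2real (corr_integral X \<nu> A r)) / ln r)"
  show "\<forall>\<^sub>F r in at_right 0. 0 < corr_integral X \<nu> A r \<and> corr_integral X \<nu> A r < \<infinity>"
    using assms by (auto simp: corr_exponent_def split: if_splits)
  have "lim0 ?f = Some L"
    using assms by (auto simp: corr_exponent_def split: if_splits)
  then obtain L' where "(?f \<longlongrightarrow> L') (at_right 0)" "L = Lim (at_right 0) ?f"
    by (auto simp: lim0_def split: if_splits)
  then show "(?f \<longlongrightarrow> L) (at_right 0)"
    by (metis tendsto_Lim trivial_limit_at_right_real)
qed

lemma MC_exponents_mono: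
  assumes "\<delta> \<le> \<delta>'"
  shows "MC_exponents X \<nu> \<delta> \<subseteq> MC_exponents X \<nu> \<delta>'"
proof
  fix L assume "L \<in> MC_exponents X \<nu> \<delta>"
  moreover from assms have "ennreal (1 - \<delta>') \<le> ennreal (1 - \<delta>)"
    by (intro ennreal_leI) simp
  ultimately show "L \<in> MC_exponents X \<nu> \<delta>'"
    unfolding MC_exponents_def by (blast intro: order_trans)
qed

lemma dim_MC_eqI:
  assumes "0 < \<delta>0" and sing: "\<And>\<delta>. 0 < \<delta> \<Longrightarrow> \<delta> < \<delta>0 \<Longrightarrow> MC_exponents X \<nu> \<delta> = {L}"
  shows "dim_MC X \<nu> = Some L"
proof -
  have ne: "MC_exponents X \<nu> \<delta> \<noteq> {}" if "\<delta> > 0" for \<delta>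
    using MC_exponents_mono[of "min \<delta> (\<delta>0/2)" \<delta> X \<nu>] sing[of "min \<delta> (\<delta>0/2)"] that assms(1) by auto
  have "\<forall>\<^sub>F \<delta> in at_right 0. L = Sup (MC_exponents X \<nu> \<delta>)"
    using assms by (auto simp: eventually_at_right_field intro!: exI[of _ \<delta>0])
  then have lim: "((\<lambda>\<delta>. Sup (MC_exponents X \<nu> \<delta>)) \<longlongrightarrow> L) (at_right 0)"
    by (rule Lim_transform_eventually[OF tendsto_const])
  then have "Lim (at_right 0) (\<lambda>\<delta>. Sup (MC_exponents X \<nu> \<delta>)) = L"
    by (intro tendsto_Lim) auto
  with lim ne show ?thesis
    by (auto simp: dim_MC_def lim0_def)
qed

text \<open>The outer limit always exists once the suprema are over nonempty sets, since they shrink with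
  \<open>\<delta>\<close>.  A single exponent available for every \<open>\<delta>\<close> thus bounds the dimension from below without the
  need to determine it.\<close>

lemma dim_MC_geI:
  assumes s: "\<And>\<delta>. 0 < \<delta> \<Longrightarrow> s \<in> MC_exponents X \<nu> \<delta>"
  shows "\<exists>L\<ge>s. dim_MC X \<nu> = Some L"
proof -
  define f where "f \<delta> = Sup (MC_exponents X \<nu> \<delta>)" for \<delta>
  define L where "L = (INF \<delta>\<in>{0<..}. f \<delta>)"
  have ge: "s \<le> f \<delta>" if "0 < \<delta>" for \<delta>
    unfolding f_def using s[OF that] by (rule Sup_upper)
  have "s \<le> L"
    unfolding L_def by (rule INF_greatest) (use ge in auto)
  have lim: "(f \<longlongrightarrow> L) (at_right 0)"
  proof (rule order_tendstoI)
    fix a assume "a < L"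
    then show "\<forall>\<^sub>F \<delta> in at_right 0. a < f \<delta>"
      unfolding L_def eventually_at_right_field
      by (auto intro!: exI[of _ 1] elim!: less_le_trans intro: INF_lower)
  next
    fix a assume "L < a"
    then obtain \<delta>0 where "0 < \<delta>0" "f \<delta>0 < a"
      unfolding L_def by (auto simp: INF_less_iff)
    moreover have "f \<delta> \<le> f \<delta>0" if "\<delta> < \<delta>0" for \<delta>
      unfolding f_def using that by (intro Sup_subset_mono MC_exponents_mono) auto
    ultimately show "\<forall>\<^sub>F \<delta> in at_right 0. f \<delta> < a"
      unfolding eventually_at_right_field by (auto intro!: exI[of _ \<delta>0] elim: le_less_trans[rotated])
  qed
  then have "Lim (at_right 0) f = L"
    by (intro tendsto_Lim) auto
  moreover have "MC_exponents X \<nu> \<delta> \<noteq> {}" if "0 < \<delta>" for \<delta>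
    using s[OF that] by auto
  ultimately have "dim_MC X \<nu> = Some L"
    using lim by (auto simp: dim_MC_def lim0_def f_def[abs_def])
  with \<open>s \<le> L\<close> show ?thesis by blast
qed

lemma MC_exponents_osc_lineE:
  assumes "L \<in> MC_exponents osc_line \<nu> \<delta>"
  obtains A where "A \<in> sets borel" "ennreal (1 - \<delta>) \<le> emeasure \<nu> A"
    "corr_exponent osc_line \<nu> A = Some L"
  using assms by (auto simp: MC_exponents_def borel_sets_osc_line)

lemma MC_exponents_osc_lineI:
  "A \<in> sets borel \<Longrightarrow> ennreal (1 - \<delta>) \<le> emeasure \<nu> A \<Longrightarrow>
    corr_exponent osc_line \<nu> A = Some L \<Longrightarrow> L \<in> MC_exponents osc_line \<nu> \<delta>"
  by (auto simp: MC_exponents_def borel_sets_osc_line)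

lemma corr_integral_ge:
  assumes "A' \<in> sets \<nu>" "A' \<subseteq> A" "\<And>x. x \<in> A' \<Longrightarrow> q \<le> emeasure \<nu> (mball_of X x r)"
  shows "q * emeasure \<nu> A' \<le> corr_integral X \<nu> A r"
proof -
  have "q * emeasure \<nu> A' = (\<integral>\<^sup>+x. q * indicator A' x \<partial>\<nu>)"
    using assms(1) by (simp add: nn_integral_cmult_indicator)
  also have "\<dots> \<le> corr_integral X \<nu> A r"
    unfolding corr_integral_def using assms
    by (intro nn_integral_mono) (auto split: split_indicator)
  finally show ?thesis .
qed

text \<open>The set S carries the part of A that matters; the balls around the remaining points of A
  may be large.\<close>

lemma corr_integral_le:
  assumes "A \<in> sets \<nu>" "S \<in> sets \<nu>" "emeasure \<nu> (A - S) = 0"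
    and le: "\<And>x. x \<in> A \<Longrightarrow> x \<in> S \<Longrightarrow> emeasure \<nu> (mball_of X x r) \<le> q"
  shows "corr_integral X \<nu> A r \<le> q * emeasure \<nu> A"
proof -
  have "AE x in \<nu>. x \<notin> A - S"
    using assms by (intro AE_not_in) (auto simp: null_sets_def)
  then have "corr_integral X \<nu> A r \<le> (\<integral>\<^sup>+x. q * indicator A x \<partial>\<nu>)"
    unfolding corr_integral_def
    by (intro nn_integral_mono_AE, eventually_elim) (auto split: split_indicator intro: le)
  also have "\<dots> = q * emeasure \<nu> A"
    using assms(1) by (simp add: nn_integral_cmult_indicator)
  finally show ?thesis .
qed

text \<open>The upper bound is asked for on all of A, the lower bound only on a part of it: a piece of exponent
  1 dominates whatever is thinner.\<close>

lemma corr_exponent_one: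
  assumes "finite_measure \<nu>" "A \<in> sets \<nu>" "A' \<in> sets \<nu>" "A' \<subseteq> A" "0 < emeasure \<nu> A'"
    and ab: "0 < a" "0 < b"
    and ev: "\<forall>\<^sub>F r in at_right 0. (\<forall>x\<in>A'. ennreal (a * r) \<le> emeasure \<nu> (mball_of X x r)) \<and>
      (\<forall>x\<in>A. emeasure \<nu> (mball_of X x r) \<le> ennreal (b * r))"
  shows "corr_exponent X \<nu> A = Some 1"
proof -
  interpret finite_measure \<nu> by fact
  define m where "m = measure \<nu> A'"
  define M where "M = measure \<nu> A"
  have m: "0 < m" using assms(5) by (simp add: m_def emeasure_eq_measure)
  have "m \<le> M" unfolding m_def M_def using assms by (intro finite_measure_mono) auto
  with m have M: "0 < M" by simp
  have r1: "\<forall>\<^sub>F r in at_right 0. 0 < (r::real)"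
    by (auto simp: eventually_at_right_field intro: exI[of _ 1])
  have "corr_exponent X \<nu> A = Some (ereal 1)"
  proof (rule corr_exponent_eqI)
    show "\<forall>\<^sub>F r in at_right 0. 0 < a * r * m \<and> ennreal (a * r * m) \<le> corr_integral X \<nu> A r
        \<and> corr_integral X \<nu> A r \<le> ennreal (b * r * M)"
      using ev r1
    proof eventually_elim
      case (elim r)
      have "ennreal (a * r) * emeasure \<nu> A' \<le> corr_integral X \<nu> A r"
        using assms elim by (intro corr_integral_ge) auto
      moreover have "corr_integral X \<nu> A r \<le> ennreal (b * r) * emeasure \<nu> A"
        using assms elim by (intro corr_integral_le[where S=A]) auto
      ultimately show ?case
        using ab elim m M
        by (simp add: emeasure_eq_measure m_def[symmetric] M_def[symmetric] ennreal_mult[symmetric])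
    qed
    show "((\<lambda>r. ln (a * r * m) / ln r) \<longlongrightarrow> 1) (at_right 0)" using ab m by real_asymp
    show "((\<lambda>r. ln (b * r * M) / ln r) \<longlongrightarrow> 1) (at_right 0)" using ab M by real_asymp
  qed
  then show ?thesis by (simp add: one_ereal_def)
qed

text \<open>The square of the mass of the atom and the square of the total mass bound the correlation integral
  at every scale.\<close>

lemma corr_exponent_atom:
  assumes "finite_measure \<nu>" and sp: "space \<nu> = mspace X" and ball: "\<And>x r. mball_of X x r \<in> sets \<nu>"
    and p: "p \<in> A" "A \<in> sets \<nu>" "{p} \<in> sets \<nu>" "0 < emeasure \<nu> {p}"
  shows "corr_exponent X \<nu> A = Some 0"
proof -
  interpret finite_measure \<nu> by fact
  define m where "m = measure \<nu> {p}"
  define M where "M = measure \<nu> (space \<nu>)"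
  have m: "0 < m" using p by (simp add: m_def emeasure_eq_measure)
  have "m \<le> M" unfolding m_def M_def by (rule bounded_measure)
  with m have M: "0 < M" by simp
  have r1: "\<forall>\<^sub>F r in at_right 0. 0 < (r::real)"
    by (auto simp: eventually_at_right_field intro: exI[of _ 1])
  have "corr_exponent X \<nu> A = Some (ereal 0)"
  proof (rule corr_exponent_eqI)
    show "\<forall>\<^sub>F r in at_right 0. 0 < m * m \<and> ennreal (m * m) \<le> corr_integral X \<nu> A r
        \<and> corr_integral X \<nu> A r \<le> ennreal (M * M)"
      using r1
    proof eventually_elim
      case (elim r)
      have "p \<in> mspace X" using p sp sets.sets_into_space by blast
      then have "p \<in> mball_of X p r"
        using elim by (simp add: mball_of_def Metric_space.centre_in_mball_iff[OF Metric_space_mspace_mdist])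
      then have "emeasure \<nu> {p} \<le> emeasure \<nu> (mball_of X p r)"
        using ball by (intro emeasure_mono) auto
      then have lower: "emeasure \<nu> {p} * emeasure \<nu> {p} \<le> corr_integral X \<nu> A r"
        using p by (intro corr_integral_ge) auto
      have "corr_integral X \<nu> A r \<le> emeasure \<nu> (space \<nu>) * emeasure \<nu> A"
        using p by (intro corr_integral_le[where S=A]) (auto intro: emeasure_space)
      then have "corr_integral X \<nu> A r \<le> emeasure \<nu> (space \<nu>) * emeasure \<nu> (space \<nu>)"
        by (rule order_trans) (intro mult_left_mono emeasure_space, simp)
      with lower show ?case
        using m M
        by (simp add: emeasure_eq_measure m_def[symmetric] M_def[symmetric] ennreal_mult[symmetric])
    qed
    show "((\<lambda>r. ln (m * m) / ln r) \<longlongrightarrow> 0) (at_right 0)" using m by real_asymp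
    show "((\<lambda>r. ln (M * M) / ln r) \<longlongrightarrow> 0) (at_right 0)" using M by real_asymp
  qed
  then show ?thesis by (simp add: zero_ereal_def)
qed

text \<open>At least one of the two halves of the ball stays inside the interval.\<close>

lemma lborel_Icc_inter_ball_ge:
  fixes x :: real
  assumes "x \<in> {u..v}" "0 < h" "h \<le> (v - u) / 2"
  shows "ennreal h \<le> emeasure lborel ({u..v} \<inter> {x-h<..<x+h})"
proof (cases "x \<le> (u + v) / 2")
  case True
  have "ennreal h = emeasure lborel {x..<x+h}" using assms by simp
  also have "\<dots> \<le> emeasure lborel ({u..v} \<inter> {x-h<..<x+h})"
    using assms True by (intro emeasure_mono) auto
  finally show ?thesis .
next
  case False
  have "ennreal h = emeasure lborel {x-h<..x}" using assms by simp
  also have "\<dots> \<le> emeasure lborel ({u..v} \<inter> {x-h<..<x+h})"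
    using assms False by (intro emeasure_mono) (auto simp: field_simps)
  finally show ?thesis .
qed

lemma lborel_subset_Icc_le:
  fixes x :: real
  assumes "S \<subseteq> {x-h..x+h}" "0 \<le> h"
  shows "emeasure lborel S \<le> ennreal (2 * h)"
proof -
  have "emeasure lborel S \<le> emeasure lborel {x-h..x+h}"
    using assms by (intro emeasure_mono) auto
  then show ?thesis using assms by simp
qed

lemma emeasure_law_mball:
  assumes [measurable]: "c \<in> borel_measurable borel" "E \<in> sets borel"
  shows "emeasure (law c E) (mball_of osc_line x r) = emeasure lborel {y \<in> E. osc_dist x (c y) < r}"
proof -
  have "E \<inter> c -` mball_of osc_line x r = {y \<in> E. osc_dist x (c y) < r}"
    by (auto simp only: mball_osc_line vimage_def)
  then show ?thesis by (simp only: emeasure_law[OF assms mball_osc_line_borel])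
qed

lemma law_mball_vimage_borel:
  assumes "c \<in> borel_measurable borel" "E \<in> sets borel"
  shows "{y \<in> E. osc_dist x (c y) < r} \<in> sets borel"
proof -
  have "{y \<in> E. osc_dist x (c y) < r} = E \<inter> c -` mball_of osc_line x r"
    by (auto simp only: mball_osc_line vimage_def)
  also have "\<dots> \<in> sets borel"
    by (intro sets.Int assms measurable_sets_borel[OF assms(1)] mball_osc_line_borel)
  finally show ?thesis .
qed

lemma finite_measure_law:
  assumes [measurable]: "c \<in> borel_measurable borel" "E \<in> sets borel" and "emeasure lborel E < \<infinity>"
  shows "finite_measure (law c E)"
proof (rule finite_measureI)
  have "emeasure (law c E) UNIV = emeasure lborel E"
    using emeasure_law[OF assms(1,2), of UNIV] by simp
  then show "emeasure (law c E) (space (law c E)) \<noteq> \<infinity>"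
    using assms(3) by auto
qed

lemma osc_dist_ge: "\<bar>x - y\<bar> \<le> osc_dist x y"
  unfolding osc_dist_def by (rule max.cobounded1)

lemma osc_dist_eq_of_nonneg:
  assumes "0 \<le> x" "0 \<le> y"
  shows "osc_dist x y = \<bar>x - y\<bar>"
  unfolding osc_dist_def min_absorb2[OF assms(1)] min_absorb2[OF assms(2)] by simp


section \<open>Lebesgue measure with an atom\<close>

text \<open>Truncation at 2 turns the part of E beyond 2 into an atom at 2 and leaves the rest in place, so
  that the measures with and without atoms are all indexed by sets.\<close>

definition with_atom :: "real set \<Rightarrow> real measure" where
  "with_atom E = law (\<lambda>x. min x 2) E"

lemma cap_borel [measurable]: "(\<lambda>x::real. min x 2) \<in> borel_measurable borel"
  by simp

lemma sets_with_atom [simp]: "sets (with_atom E) = sets borel"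
  and space_with_atom [simp]: "space (with_atom E) = UNIV"
  by (simp_all add: with_atom_def)

lemma with_atom_in_borel_measures: "with_atom E \<in> borel_measures osc_line"
  unfolding with_atom_def by (rule law_in_borel_measures)

lemma emeasure_with_atom:
  assumes "E \<in> sets borel" "A \<in> sets borel"
  shows "emeasure (with_atom E) A = emeasure lborel {x \<in> E. min x 2 \<in> A}"
  unfolding with_atom_def emeasure_law[OF cap_borel assms]
  by (intro arg_cong[where f="emeasure lborel"]) auto

lemma emeasure_with_atom_UNIV:
  "E \<in> sets borel \<Longrightarrow> emeasure (with_atom E) UNIV = emeasure lborel E"
  using emeasure_with_atom[of E UNIV] by simp

lemma finite_measure_with_atom:
  "E \<in> sets borel \<Longrightarrow> emeasure lborel E < \<infinity> \<Longrightarrow> finite_measure (with_atom E)"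
  unfolding with_atom_def by (rule finite_measure_law[OF cap_borel])

lemma with_atom_ball_le:
  assumes "E \<in> sets borel" "0 < r" "r \<le> 1" "x \<le> 1 \<or> E \<subseteq> {..2}"
  shows "emeasure (with_atom E) (mball_of osc_line x r) \<le> ennreal (2 * r)"
  unfolding with_atom_def emeasure_law_mball[OF cap_borel assms(1)]
proof (rule lborel_subset_Icc_le)
  show "{y \<in> E. osc_dist x (min y 2) < r} \<subseteq> {x - r..x + r}"
  proof
    fix y assume y: "y \<in> {y \<in> E. osc_dist x (min y 2) < r}"
    then have d: "\<bar>x - min y 2\<bar> < r"
      using osc_dist_ge[of x "min y 2"] by simp
    have "y \<le> 2"
      using assms(4)
    proof
      assume "x \<le> 1"
      then show ?thesis using d assms(3) by (cases "y \<le> 2") (auto simp: min_def)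
    qed (use y in auto)
    then show "y \<in> {x - r..x + r}" using d by (auto simp: min_def)
  qed
qed (use assms in simp)

lemma with_atom_ball_ge:
  assumes "E \<in> sets borel" and uv: "0 \<le> u" "v \<le> 2" "{u..v} \<subseteq> E"
    and "x \<in> {u..v}" "0 < r" "r \<le> (v - u) / 2"
  shows "ennreal r \<le> emeasure (with_atom E) (mball_of osc_line x r)"
proof -
  have "ennreal r \<le> emeasure lborel ({u..v} \<inter> {x-r<..<x+r})"
    using assms by (intro lborel_Icc_inter_ball_ge)
  also have "\<dots> \<le> emeasure (with_atom E) (mball_of osc_line x r)"
    unfolding with_atom_def emeasure_law_mball[OF cap_borel assms(1)]
  proof (rule emeasure_mono)
    show "{u..v} \<inter> {x-r<..<x+r} \<subseteq> {y \<in> E. osc_dist x (min y 2) < r}"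
    proof
      fix y assume y: "y \<in> {u..v} \<inter> {x-r<..<x+r}"
      then have "osc_dist x (min y 2) = \<bar>x - y\<bar>"
        using assms by (subst min_absorb1) (auto intro: osc_dist_eq_of_nonneg)
      then show "y \<in> {y \<in> E. osc_dist x (min y 2) < r}"
        using y uv by auto
    qed
    show "{y \<in> E. osc_dist x (min y 2) < r} \<in> sets lborel"
      using law_mball_vimage_borel[OF cap_borel assms(1)] by simp
  qed
  finally show ?thesis .
qed

lemma with_atom_exponent_atom:
  assumes "E \<in> sets borel" "emeasure lborel E < \<infinity>" "A \<in> sets borel" "2 \<in> A"
    and "0 < emeasure lborel (E \<inter> {2..})"
  shows "corr_exponent osc_line (with_atom E) A = Some 0"
proof (rule corr_exponent_atom)
  have "{x \<in> E. min x 2 \<in> {2}} = E \<inter> {2..}" by (auto simp: min_def)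
  then show "0 < emeasure (with_atom E) {2}"
    using assms by (simp add: emeasure_with_atom)
qed (use assms in \<open>auto intro: finite_measure_with_atom\<close>)

lemma with_atom_unit_exponent:
  assumes A: "A \<in> sets borel" "0 < emeasure (with_atom {0..1}) A"
  shows "corr_exponent osc_line (with_atom {0..1}) A = Some 1"
proof (rule corr_exponent_one[where a=1 and b=2])
  show "A \<inter> {0..1} \<subseteq> A" by simp
  have "{x \<in> {0..1}. min x 2 \<in> A} = {x \<in> {0..1::real}. min x 2 \<in> A \<inter> {0..1}}"
    by (auto simp: min_def)
  then show "0 < emeasure (with_atom {0..1}) (A \<inter> {0..1})"
    using A by (simp add: emeasure_with_atom)
  have "\<forall>\<^sub>F r in at_right 0. 0 < r \<and> r < (1/2::real)"
    by (auto simp: eventually_at_right_field intro: exI[of _ "1/2"])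
  then show "\<forall>\<^sub>F r in at_right 0.
      (\<forall>x\<in>A \<inter> {0..1}. ennreal (1 * r) \<le> emeasure (with_atom {0..1}) (mball_of osc_line x r)) \<and>
      (\<forall>x\<in>A. emeasure (with_atom {0..1}) (mball_of osc_line x r) \<le> ennreal (2 * r))"
  proof eventually_elim
    case (elim r)
    then show ?case
      using with_atom_ball_ge[of "{0..1}" 0 1 _ r] with_atom_ball_le[of "{0..1}" r] by auto
  qed
  show "finite_measure (with_atom {0..1})"
    by (rule finite_measure_with_atom) auto
qed (use A in auto)

lemma dim_C_unit: "dim_C osc_line (with_atom {0..1}) = Some 1"
  unfolding dim_C_def by (rule with_atom_unit_exponent) (simp_all add: emeasure_with_atom_UNIV)

lemma dim_MC_unit: "dim_MC osc_line (with_atom {0..1}) = Some 1"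
proof (rule dim_MC_eqI[of 1])
  fix \<delta> :: real assume \<delta>: "0 < \<delta>" "\<delta> < 1"
  have U: "emeasure (with_atom {0..1}) UNIV = 1" by (simp add: emeasure_with_atom_UNIV)
  have "L = 1" if L: "L \<in> MC_exponents osc_line (with_atom {0..1}) \<delta>" for L
  proof -
    obtain A where A: "A \<in> sets borel" "ennreal (1 - \<delta>) \<le> emeasure (with_atom {0..1}) A"
        "corr_exponent osc_line (with_atom {0..1}) A = Some L"
      by (rule MC_exponents_osc_lineE[OF L])
    have "0 < ennreal (1 - \<delta>)" using \<delta> by simp
    then have "0 < emeasure (with_atom {0..1}) A" using A(2) by (rule less_le_trans)
    then show ?thesis using with_atom_unit_exponent[OF A(1)] A(3) by simp
  qed
  moreover have "1 \<in> MC_exponents osc_line (with_atom {0..1}) \<delta>"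
  proof -
    have "ennreal (1 - \<delta>) \<le> emeasure (with_atom {0..1}) UNIV"
      unfolding U using \<delta> ennreal_leI[of "1 - \<delta>" 1] by simp
    then show ?thesis
      using dim_C_unit unfolding dim_C_def mspace_osc_line by (intro MC_exponents_osc_lineI) simp_all
  qed
  ultimately show "MC_exponents osc_line (with_atom {0..1}) \<delta> = {1}" by blast
qed simp

lemma dim_C_small_atom:
  assumes "0 < e" "e < 1"
  shows "dim_C osc_line (with_atom ({0..1-e} \<union> {2..2+e})) = Some 0"
proof -
  have "({0..1-e} \<union> {2..2+e}) \<inter> {2..} = {2..2+e}" using assms by auto
  moreover have "emeasure lborel ({0..1-e} \<union> {2..2+e}) < \<infinity>"
    by (rule emeasure_bounded_finite) (simp add: bounded_Un)
  ultimately show ?thesis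
    unfolding dim_C_def using assms by (intro with_atom_exponent_atom) simp_all
qed

text \<open>The total mass is 1 and the atom has mass e, so no set of mass above \<open>1 - e\<close> avoids it.\<close>

lemma dim_MC_small_atom:
  assumes e: "0 < e" "e < 1"
  defines "\<nu> \<equiv> with_atom ({0..1-e} \<union> {2..2+e})"
  shows "dim_MC osc_line \<nu> = Some 0"
proof (rule dim_MC_eqI[of e])
  let ?E = "{0..1-e} \<union> {2..2+e}"
  have sE: "?E \<in> sets borel" by simp
  fix \<delta> :: real assume \<delta>: "0 < \<delta>" "\<delta> < e"
  have atom: "({0..1-e} \<union> {2..2+e}) \<inter> {2..} = {2..2+e}" using e by auto
  have fin: "emeasure lborel ?E < \<infinity>"
    by (rule emeasure_bounded_finite) (simp add: bounded_Un)
  have exp0: "corr_exponent osc_line \<nu> A = Some 0" if "A \<in> sets borel" "2 \<in> A" for A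
    unfolding \<nu>_def using that e fin by (intro with_atom_exponent_atom) (simp_all add: atom)
  have "L = 0" if L: "L \<in> MC_exponents osc_line \<nu> \<delta>" for L
  proof -
    obtain A where A: "A \<in> sets borel" "ennreal (1 - \<delta>) \<le> emeasure \<nu> A"
        "corr_exponent osc_line \<nu> A = Some L"
      by (rule MC_exponents_osc_lineE[OF L])
    have "2 \<in> A"
    proof (rule ccontr)
      assume "2 \<notin> A"
      then have "emeasure \<nu> A \<le> emeasure lborel {0..1-e}"
        unfolding \<nu>_def emeasure_with_atom[OF sE A(1)]
        by (intro emeasure_mono) (auto simp: min_def split: if_splits)
      also have "\<dots> = ennreal (1 - e)" using e by simp
      finally have "ennreal (1 - \<delta>) \<le> ennreal (1 - e)" using A(2) by (rule order_trans[rotated])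
      then show False using \<delta> e by simp
    qed
    then show ?thesis using exp0 A by auto
  qed
  moreover have "0 \<in> MC_exponents osc_line \<nu> \<delta>"
  proof -
    have "emeasure \<nu> UNIV = emeasure lborel ?E"
      unfolding \<nu>_def by (rule emeasure_with_atom_UNIV[OF sE])
    also have "\<dots> = emeasure lborel {0..1-e} + emeasure lborel {2..2+e}"
      using e by (intro plus_emeasure[symmetric]) auto
    also have "\<dots> = 1"
      using e by (simp add: ennreal_plus[symmetric] del: ennreal_plus)
    finally have "ennreal (1 - \<delta>) \<le> emeasure \<nu> UNIV"
      using \<delta> ennreal_leI[of "1 - \<delta>" 1] by simp
    then show ?thesis
      using exp0[of UNIV] by (intro MC_exponents_osc_lineI) simp_all
  qed
  ultimately show "MC_exponents osc_line \<nu> \<delta> = {0}" by blast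
qed (use e in simp)


section \<open>Sets without exponent\<close>

text \<open>A set that avoids the atom lives on \<open>[-1,0]\<close>.  There a ball of radius r around any point is an
  interval whose length is at most \<open>2 r\<^sup>3\<close> for \<open>r = osc_radius k\<close> and at least \<open>r\<^sup>2 / 4\<close> for
  \<open>r = 2 (osc_radius k)\<^sup>2\<close>.  An exponent would have to be at least 3 along the first scales and at
  most 2 along the second ones.\<close>

lemma corr_exponent_osc_None:
  defines "\<nu> \<equiv> with_atom ({-1..0} \<union> {2..3})"
  assumes A: "A \<in> sets borel" "2 \<notin> A" "0 < emeasure \<nu> A"
  shows "corr_exponent osc_line \<nu> A = None"
proof (rule ccontr)
  let ?E = "{-1..0} \<union> {2..3::real}"
  let ?J = "\<lambda>r. corr_integral osc_line \<nu> A r"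
  have sE: "?E \<in> sets borel" by simp
  have ball: "emeasure \<nu> (mball_of osc_line x r) = emeasure lborel {y \<in> ?E. osc_dist x (min y 2) < r}" for x r
    unfolding \<nu>_def with_atom_def by (rule emeasure_law_mball[OF cap_borel sE])
  define A' where "A' = A \<inter> {-1..0}"
  have sA': "A' \<in> sets borel" using A by (simp add: A'_def)
  have "{x \<in> ?E. min x 2 \<in> A - {-1..0}} = {}"
    using A(2) by (auto simp: min_def)
  then have null: "emeasure \<nu> (A - {-1..0}) = 0"
    unfolding \<nu>_def using A(1) sE
    by (subst emeasure_with_atom) (simp_all only: emeasure_empty sets.Diff borel_closed closed_atLeastAtMost)
  have "{x \<in> ?E. min x 2 \<in> A} = {x \<in> ?E. min x 2 \<in> A'}"
    using A(2) by (auto simp: min_def A'_def)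
  then have AA': "emeasure \<nu> A' = emeasure \<nu> A"
    using A(1) sA' by (simp add: \<nu>_def emeasure_with_atom)
  have fin: "finite_measure \<nu>"
    unfolding \<nu>_def by (intro finite_measure_with_atom emeasure_bounded_finite) (simp_all add: bounded_Un)
  define m where "m = measure \<nu> A"
  have Am: "emeasure \<nu> A = ennreal m"
    unfolding m_def by (rule finite_measure.emeasure_eq_measure[OF fin])
  have m: "0 < m" using A(3) by (simp add: Am)

  have upper: "?J (osc_radius k) \<le> ennreal (2 * osc_radius k ^ 3 * m)" for k
  proof -
    have "?J (osc_radius k) \<le> ennreal (2 * osc_radius k ^ 3) * emeasure \<nu> A"
    proof (rule corr_integral_le[where S="{-1..0}"])
      fix x :: real assume x: "x \<in> {-1..0}"
      show "emeasure \<nu> (mball_of osc_line x (osc_radius k)) \<le> ennreal (2 * osc_radius k ^ 3)"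
        unfolding ball
      proof (rule lborel_subset_Icc_le)
        show "{y \<in> ?E. osc_dist x (min y 2) < osc_radius k} \<subseteq> {x - osc_radius k ^ 3..x + osc_radius k ^ 3}"
        proof
          fix y assume y: "y \<in> {y \<in> ?E. osc_dist x (min y 2) < osc_radius k}"
          then have "\<bar>x - min y 2\<bar> < 1/2"
            using osc_dist_ge[of x "min y 2"] osc_radius_le_half[of k] by simp
          then have "min y 2 < 1"
            using x unfolding abs_less_iff atLeastAtMost_iff by linarith
          then have y1: "y < 1" by (simp add: min_less_iff_disj)
          then have y0: "y \<in> {-1..0}" "min y 2 = y" using y by auto
          then have "osc_gauge \<bar>x - y\<bar> < osc_radius k"
            using x y by (simp add: osc_dist_def min_absorb1 del: min_less_iff_conj)
          then have "\<bar>x - y\<bar> < osc_radius k ^ 3" by (rule less_cube_of_osc_gauge_less)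
          then show "y \<in> {x - osc_radius k ^ 3..x + osc_radius k ^ 3}" by auto
        qed
      qed (simp add: less_imp_le)
    qed (use A null in \<open>auto simp: \<nu>_def\<close>)
    then show ?thesis using m by (simp add: Am ennreal_mult[symmetric] less_imp_le)
  qed

  have lower: "ennreal (osc_radius k ^ 4 * m) \<le> ?J (2 * (osc_radius k)\<^sup>2)" for k
  proof -
    define h where "h = osc_radius k ^ 4"
    define a where "a = osc_radius k"
    have a: "0 < a" "a \<le> 1/2" using osc_radius_le_half[of k] by (auto simp: a_def)
    have h: "0 < h" "h \<le> a\<^sup>2" "h \<le> 1/2"
      using a power_decreasing[of 2 4 a] power_decreasing[of 1 4 a] by (auto simp: h_def a_def[symmetric])
    have "ennreal h * emeasure \<nu> A' \<le> ?J (2 * a\<^sup>2)"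
    proof (rule corr_integral_ge)
      fix x assume "x \<in> A'"
      then have x: "x \<in> {-1..0}" by (simp add: A'_def)
      have "ennreal h \<le> emeasure lborel ({-1..0} \<inter> {x-h<..<x+h})"
        using x h by (intro lborel_Icc_inter_ball_ge) auto
      also have "\<dots> \<le> emeasure \<nu> (mball_of osc_line x (2 * a\<^sup>2))"
        unfolding ball
      proof (rule emeasure_mono)
        show "{-1..0} \<inter> {x-h<..<x+h} \<subseteq> {y \<in> ?E. osc_dist x (min y 2) < 2 * a\<^sup>2}"
        proof
          fix y assume y: "y \<in> {-1..0} \<inter> {x-h<..<x+h}"
          then have xy: "\<bar>x - y\<bar> < h" by auto
          then have "osc_gauge \<bar>x - y\<bar> \<le> a\<^sup>2"
            unfolding a_def by (intro osc_gauge_le_square) (auto simp: h_def)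
          then have "osc_dist x (min y 2) < 2 * a\<^sup>2"
            using x y xy h by (simp add: osc_dist_def min_absorb1)
          then show "y \<in> {y \<in> ?E. osc_dist x (min y 2) < 2 * a\<^sup>2}" using y by auto
        qed
        show "{y \<in> ?E. osc_dist x (min y 2) < 2 * a\<^sup>2} \<in> sets lborel"
          using law_mball_vimage_borel[OF cap_borel sE] by simp
      qed
      finally show "ennreal h \<le> emeasure \<nu> (mball_of osc_line x (2 * a\<^sup>2))" .
    qed (use sA' in \<open>auto simp: \<nu>_def A'_def\<close>)
    then show ?thesis
      using m h(1) by (simp add: AA' Am ennreal_mult[symmetric] less_imp_le h_def a_def)
  qed

  assume "corr_exponent osc_line \<nu> A \<noteq> None"
  then obtain L where L: "corr_exponent osc_line \<nu> A = Some L" by auto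
  note pos = corr_exponent_SomeD(1)[OF L] and lim = corr_exponent_SomeD(2)[OF L]
  let ?q = "\<lambda>r. ln (enn2real (?J r)) / ln r"
  have ev2: "filterlim (\<lambda>k. 2 * (osc_radius k)\<^sup>2) (at_right 0) sequentially"
  proof (rule filterlim_compose[OF _ osc_radius_tendsto])
    show "filterlim (\<lambda>x::real. 2 * x\<^sup>2) (at_right 0) (at_right 0)" by real_asymp
  qed
  have "3 \<le> L"
  proof (rule LIMSEQ_le)
    have "((\<lambda>x. (ln (2 * x ^ 3 * m)) / ln x) \<longlongrightarrow> 3) (at_right 0)"
      using m by real_asymp
    then have "(\<lambda>k. ln (2 * osc_radius k ^ 3 * m) / ln (osc_radius k)) \<longlonglongrightarrow> 3"
      using osc_radius_tendsto by (rule filterlim_compose)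
    then show "(\<lambda>k. ereal (ln (2 * osc_radius k ^ 3 * m) / ln (osc_radius k))) \<longlonglongrightarrow> 3"
      using tendsto_ereal by fastforce
    show "(\<lambda>k. ereal (?q (osc_radius k))) \<longlonglongrightarrow> L"
      using lim osc_radius_tendsto by (rule filterlim_compose)
    have "\<forall>\<^sub>F k in sequentially. ereal (ln (2 * osc_radius k ^ 3 * m) / ln (osc_radius k)) \<le> ereal (?q (osc_radius k))"
      using eventually_compose_filterlim[OF pos osc_radius_tendsto]
    proof eventually_elim
      case (elim k)
      then have "0 < enn2real (?J (osc_radius k))" by (simp add: enn2real_positive_iff)
      moreover have "enn2real (?J (osc_radius k)) \<le> 2 * osc_radius k ^ 3 * m"
        using upper[of k] m by (intro enn2real_leI) (auto simp: less_imp_le)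
      moreover have "ln (osc_radius k) \<le> 0" using osc_radius_le_half[of k] by simp
      ultimately show ?case
        unfolding ereal_less_eq by (intro divide_right_mono_neg ln_mono) auto
    qed
    then show "\<exists>N. \<forall>n\<ge>N. ereal (ln (2 * osc_radius n ^ 3 * m) / ln (osc_radius n)) \<le> ereal (?q (osc_radius n))"
      by (simp add: eventually_sequentially)
  qed
  moreover have "L \<le> 2"
  proof (rule LIMSEQ_le)
    have "((\<lambda>x. (ln (x ^ 4 * m)) / ln (2 * x\<^sup>2)) \<longlongrightarrow> 2) (at_right 0)"
      using m by real_asymp
    then have "(\<lambda>k. ln (osc_radius k ^ 4 * m) / ln (2 * (osc_radius k)\<^sup>2)) \<longlonglongrightarrow> 2"
      using osc_radius_tendsto by (rule filterlim_compose)
    then show "(\<lambda>k. ereal (ln (osc_radius k ^ 4 * m) / ln (2 * (osc_radius k)\<^sup>2))) \<longlonglongrightarrow> 2"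
      using tendsto_ereal by fastforce
    show "(\<lambda>k. ereal (?q (2 * (osc_radius k)\<^sup>2))) \<longlonglongrightarrow> L"
      using lim ev2 by (rule filterlim_compose)
    have "\<forall>\<^sub>F k in sequentially. ereal (?q (2 * (osc_radius k)\<^sup>2)) \<le> ereal (ln (osc_radius k ^ 4 * m) / ln (2 * (osc_radius k)\<^sup>2))"
      using eventually_compose_filterlim[OF pos ev2]
    proof eventually_elim
      case (elim k)
      let ?r = "2 * (osc_radius k)\<^sup>2"
      have "ennreal (osc_radius k ^ 4 * m) \<le> ennreal (enn2real (?J ?r))"
        using lower[of k] elim by simp
      then have "osc_radius k ^ 4 * m \<le> enn2real (?J ?r)" by simp
      moreover have "(osc_radius k)\<^sup>2 \<le> (1/2)\<^sup>2"
        using osc_radius_le_half[of k] by (intro power_mono) (auto simp: less_imp_le)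
      then have "ln ?r \<le> 0" by (simp add: power2_eq_square)
      moreover have "0 < osc_radius k ^ 4 * m"
        by (intro mult_pos_pos zero_less_power osc_radius_pos m)
      ultimately show ?case
        unfolding ereal_less_eq by (intro divide_right_mono_neg ln_mono) auto
    qed
    then show "\<exists>N. \<forall>n\<ge>N. ereal (?q (2 * (osc_radius n)\<^sup>2)) \<le> ereal (ln (osc_radius n ^ 4 * m) / ln (2 * (osc_radius n)\<^sup>2))"
      by (simp add: eventually_sequentially)
  qed
  ultimately have "(3::ereal) \<le> 2" by (rule order_trans)
  then show False by simp
qed

text \<open>For \<open>\<delta> < 1\<close> the admissible sets have positive mass, so those that avoid the atom have no
  exponent.\<close>

lemma dim_MC_osc: "dim_MC osc_line (with_atom ({-1..0} \<union> {2..3})) = Some 0"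
proof (rule dim_MC_eqI[of 1])
  let ?E = "{-1..0} \<union> {2..3::real}" and ?\<nu> = "with_atom ({-1..0} \<union> {2..3})"
  have sE: "?E \<in> sets borel" by simp
  have atom: "?E \<inter> {2..} = {2..3}" by auto
  have fin: "emeasure lborel ?E < \<infinity>"
    by (rule emeasure_bounded_finite) (simp add: bounded_Un)
  have exp0: "corr_exponent osc_line ?\<nu> A = Some 0" if "A \<in> sets borel" "2 \<in> A" for A
    using that fin by (intro with_atom_exponent_atom) (simp_all add: atom)
  fix \<delta> :: real assume \<delta>: "0 < \<delta>" "\<delta> < 1"
  have "L = 0" if L: "L \<in> MC_exponents osc_line ?\<nu> \<delta>" for L
  proof -
    obtain A where A: "A \<in> sets borel" "ennreal (1 - \<delta>) \<le> emeasure ?\<nu> A"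
        "corr_exponent osc_line ?\<nu> A = Some L"
      by (rule MC_exponents_osc_lineE[OF L])
    have "0 < ennreal (1 - \<delta>)" using \<delta> by simp
    then have "0 < emeasure ?\<nu> A" using A(2) by (rule less_le_trans)
    then have "2 \<in> A" using corr_exponent_osc_None[OF A(1)] A(3) by auto
    then show ?thesis using exp0 A by auto
  qed
  moreover have "0 \<in> MC_exponents osc_line ?\<nu> \<delta>"
  proof -
    have "ennreal (1 - \<delta>) \<le> ennreal 1" using \<delta> by (intro ennreal_leI) simp
    also have "\<dots> = emeasure lborel {2..3::real}" by simp
    also have "\<dots> \<le> emeasure ?\<nu> UNIV"
      unfolding emeasure_with_atom_UNIV[OF sE] by (rule emeasure_mono) auto
    finally show ?thesis
      using exp0[of UNIV] by (intro MC_exponents_osc_lineI) simp_all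
  qed
  ultimately show "MC_exponents osc_line ?\<nu> \<delta> = {0}" by blast
qed simp

text \<open>The witness is the complement of the atom in the support, written as \<open>{..1}\<close>.  For small r the
  balls around its points have mass at most \<open>2 r\<close> because the metric dominates the usual distance, and
  those around the points of \<open>[0,e]\<close>, where the metric is the usual one, have mass at least r.\<close>

lemma dim_MC_osc_extended:
  assumes e: "0 < e" "e \<le> 1"
  shows "\<exists>L\<ge>1. dim_MC osc_line (with_atom ({-1..e} \<union> {2..3})) = Some L"
proof (rule dim_MC_geI)
  let ?E = "{-1..e} \<union> {2..3::real}" and ?\<nu> = "with_atom ({-1..e} \<union> {2..3})"
  have sE: "?E \<in> sets borel" by simp
  have mass: "emeasure lborel B \<le> emeasure ?\<nu> B" if "B \<subseteq> {-1..e}" "B \<in> sets borel" for B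
    unfolding emeasure_with_atom[OF sE that(2)] using that e sE
    by (intro emeasure_mono) (auto simp: min_absorb1 intro!: sets.sets_Collect)
  have exp1: "corr_exponent osc_line ?\<nu> {..1} = Some 1"
  proof (rule corr_exponent_one[where a=1 and b=2])
    show "{0..e} \<subseteq> {..1}" using e by auto
    have "0 < emeasure lborel {0..e}" using e by simp
    also have "\<dots> \<le> emeasure ?\<nu> {0..e}" by (rule mass) auto
    finally show "0 < emeasure ?\<nu> {0..e}" .
    have sub: "{0..e} \<subseteq> ?E" by auto
    have "\<forall>\<^sub>F r in at_right 0. 0 < r \<and> r < e / 2"
      using e by (auto simp: eventually_at_right_field intro: exI[of _ "e/2"])
    then show "\<forall>\<^sub>F r in at_right 0.
        (\<forall>x\<in>{0..e}. ennreal (1 * r) \<le> emeasure ?\<nu> (mball_of osc_line x r)) \<and>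
        (\<forall>x\<in>{..1}. emeasure ?\<nu> (mball_of osc_line x r) \<le> ennreal (2 * r))"
    proof eventually_elim
      case (elim r)
      then show ?case
        using with_atom_ball_ge[OF sE _ _ sub, of _ r] with_atom_ball_le[OF sE, of r] e by auto
    qed
    show "finite_measure ?\<nu>"
      by (intro finite_measure_with_atom emeasure_bounded_finite) (simp_all add: bounded_Un)
  qed auto
  fix \<delta> :: real assume \<delta>: "0 < \<delta>"
  have "ennreal (1 - \<delta>) \<le> ennreal 1" using \<delta> by (intro ennreal_leI) simp
  also have "\<dots> = emeasure lborel {-1..0::real}" by simp
  also have "\<dots> \<le> emeasure ?\<nu> {-1..0}" using e by (intro mass) auto
  also have "\<dots> \<le> emeasure ?\<nu> {..1}" by (rule emeasure_mono) auto
  finally show "1 \<in> MC_exponents osc_line ?\<nu> \<delta>"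
    using exp1 by (intro MC_exponents_osc_lineI) simp_all
qed

section \<open>Slow concentration at a point\<close>

definition spike :: "real \<Rightarrow> real" where
  "spike x = exp (- 1 / x)"

lemma spike_borel [measurable]: "spike \<in> borel_measurable borel"
  unfolding spike_def by measurable

lemma spike_pos [simp]: "0 < spike x"
  by (simp add: spike_def)

lemma osc_dist_spike: "osc_dist (spike x) (spike y) = \<bar>spike x - spike y\<bar>"
  by (rule osc_dist_eq_of_nonneg) (simp_all add: less_imp_le)

text \<open>The points of \<open>(0,r]\<close> are less than r apart and have total mass \<open>-1 / ln r\<close>.\<close>

lemma dim_C_spike: "dim_C osc_line (law spike {0<..1}) = Some 0"
proof -
  let ?\<nu> = "law spike {0<..1}"
  have sE: "{0<..1::real} \<in> sets borel" by simp
  have U: "emeasure ?\<nu> UNIV = 1"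
    using emeasure_law[OF spike_borel sE, of UNIV] by simp
  have "corr_exponent osc_line ?\<nu> UNIV = Some (ereal 0)"
  proof (rule corr_exponent_eqI)
    have "\<forall>\<^sub>F r in at_right 0. 0 < r \<and> r < exp (-1::real)"
      by (auto simp: eventually_at_right_field intro: exI[of _ "exp (-1)"])
    then show "\<forall>\<^sub>F r in at_right 0. 0 < (1 / ln r)\<^sup>2
        \<and> ennreal ((1 / ln r)\<^sup>2) \<le> corr_integral osc_line ?\<nu> UNIV r
        \<and> corr_integral osc_line ?\<nu> UNIV r \<le> ennreal 1"
    proof eventually_elim
      case (elim r)
      define s where "s = - 1 / ln r"
      have lr: "ln r < -1"
        using elim by (metis exp_gt_zero ln_exp ln_less_cancel_iff)
      have s: "0 < s" "s \<le> 1"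
        using lr by (auto simp: s_def field_simps)
      have small: "spike y \<le> r" if "y \<in> {0<..s}" for y
      proof -
        have "- 1 / y \<le> ln r"
          using that lr by (auto simp: s_def field_simps)
        then have "spike y \<le> exp (ln r)"
          unfolding spike_def by (simp only: exp_le_cancel_iff)
        then show ?thesis using elim by simp
      qed
      have sub: "{0<..s} \<subseteq> {y \<in> {0<..1}. spike y \<in> {0<..r}}"
        using small s by auto
      have "ennreal s = emeasure lborel {0<..s}" using s by simp
      also have "\<dots> \<le> emeasure lborel ({0<..1} \<inter> spike -` {0<..r})"
        using sub by (intro emeasure_mono) (auto intro!: sets.Int measurable_sets_borel[OF spike_borel])
      also have "\<dots> = emeasure ?\<nu> {0<..r}" by (rule emeasure_law[symmetric]) auto
      finally have mass: "ennreal s \<le> emeasure ?\<nu> {0<..r}" .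
      have "ennreal (s\<^sup>2) = ennreal s * ennreal s"
        using s by (simp add: ennreal_mult power2_eq_square)
      also have "\<dots> \<le> ennreal s * emeasure ?\<nu> {0<..r}"
        using mass by (rule mult_left_mono) simp
      also have "\<dots> \<le> corr_integral osc_line ?\<nu> UNIV r"
      proof (rule corr_integral_ge)
        fix x assume x: "x \<in> {0<..r}"
        have "{0<..r} \<subseteq> mball_of osc_line x r"
          using x by (auto simp: mball_osc_line osc_dist_eq_of_nonneg)
        then have "emeasure ?\<nu> {0<..r} \<le> emeasure ?\<nu> (mball_of osc_line x r)"
          by (rule emeasure_mono) simp
        with mass show "ennreal s \<le> emeasure ?\<nu> (mball_of osc_line x r)" by (rule order_trans)
      qed auto
      finally have "ennreal ((1 / ln r)\<^sup>2) \<le> corr_integral osc_line ?\<nu> UNIV r"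
        by (simp add: s_def)
      moreover have "corr_integral osc_line ?\<nu> UNIV r \<le> 1 * emeasure ?\<nu> UNIV"
        by (rule corr_integral_le[where S=UNIV]) (auto simp: U[symmetric] intro!: emeasure_mono)
      ultimately show ?case using lr by (simp add: U)
    qed
    show "((\<lambda>r. ln ((1 / ln r)\<^sup>2) / ln r) \<longlongrightarrow> 0) (at_right (0::real))" by real_asymp
    show "((\<lambda>r. ln 1 / ln r) \<longlongrightarrow> 0) (at_right (0::real))" by simp
  qed
  then show ?thesis by (simp add: dim_C_def zero_ereal_def)
qed

lemma spike_bilipschitz:
  assumes e: "0 < e" and xy: "x \<in> {e..1}" "y \<in> {e..1}"
  shows "spike e * \<bar>x - y\<bar> \<le> \<bar>spike x - spike y\<bar>"
    and "\<bar>spike x - spike y\<bar> \<le> \<bar>x - y\<bar> / e\<^sup>2"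
proof -
  have *: "spike e * (v - u) \<le> spike v - spike u \<and> spike v - spike u \<le> (v - u) / e\<^sup>2"
    if uv: "e \<le> u" "u < v" "v \<le> 1" for u v
  proof -
    have "DERIV spike z :> spike z / z\<^sup>2" if "u \<le> z" "z \<le> v" for z
      unfolding spike_def[abs_def] using that uv e
      by (auto intro!: derivative_eq_intros simp: power2_eq_square)
    from MVT2[OF uv(2) this] obtain z where z: "u < z" "z < v" "spike v - spike u = (v - u) * (spike z / z\<^sup>2)"
      by blast
    have "spike e \<le> spike z"
      using z uv e by (auto simp: spike_def frac_le)
    moreover have "z\<^sup>2 \<le> 1" "e\<^sup>2 \<le> z\<^sup>2"
      using z uv e by (auto intro: power_mono power_le_one)
    moreover have "spike z \<le> 1" using z uv e by (simp add: spike_def)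
    moreover have "0 < e\<^sup>2" "0 < z\<^sup>2" using e z uv by auto
    ultimately have "spike e / 1 \<le> spike z / z\<^sup>2" "spike z / z\<^sup>2 \<le> 1 / e\<^sup>2"
      by (auto intro!: frac_le simp del: div_by_1 simp: less_imp_le)
    then have "(v - u) * spike e \<le> spike v - spike u" "spike v - spike u \<le> (v - u) * (1 / e\<^sup>2)"
      unfolding z(3) using uv by (intro mult_left_mono; simp)+
    then show ?thesis by (simp add: mult.commute)
  qed
  have pos: "0 \<le> spike e * \<bar>x - y\<bar>" by (simp add: less_imp_le)
  consider "x < y" | "x = y" | "y < x" by linarith
  then have "spike e * \<bar>x - y\<bar> \<le> \<bar>spike x - spike y\<bar> \<and> \<bar>spike x - spike y\<bar> \<le> \<bar>x - y\<bar> / e\<^sup>2"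
  proof cases
    case 1
    with *[of x y] xy have "spike e * (y - x) \<le> spike y - spike x \<and> spike y - spike x \<le> (y - x) / e\<^sup>2" by auto
    moreover have "\<bar>x - y\<bar> = y - x" "0 \<le> spike e * (y - x)" using 1 by (auto simp: less_imp_le)
    ultimately show ?thesis by auto
  next
    case 3
    with *[of y x] xy have "spike e * (x - y) \<le> spike x - spike y \<and> spike x - spike y \<le> (x - y) / e\<^sup>2" by auto
    moreover have "\<bar>x - y\<bar> = x - y" "0 \<le> spike e * (x - y)" using 3 by (auto simp: less_imp_le)
    ultimately show ?thesis by auto
  qed simp
  then show "spike e * \<bar>x - y\<bar> \<le> \<bar>spike x - spike y\<bar>"
    and "\<bar>spike x - spike y\<bar> \<le> \<bar>x - y\<bar> / e\<^sup>2" by auto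
qed

lemma dim_C_spike_truncated:
  assumes e: "0 < e" "e < 1"
  shows "dim_C osc_line (law spike {e..1}) = Some 1"
  unfolding dim_C_def mspace_osc_line
proof (rule corr_exponent_one[where A'="spike ` {e..1}" and a="e\<^sup>2" and b="4 / spike e"])
  let ?\<nu> = "law spike {e..1}"
  have sE: "{e..1} \<in> sets borel" by simp
  have ball: "emeasure ?\<nu> (mball_of osc_line x r) = emeasure lborel {y \<in> {e..1}. osc_dist x (spike y) < r}" for x r
    by (rule emeasure_law_mball[OF spike_borel sE])
  have "continuous_on {e..1} spike"
    unfolding spike_def using e by (auto intro!: continuous_intros)
  then have im: "spike ` {e..1} \<in> sets borel"
    by (intro borel_compact compact_continuous_image) auto
  then show "spike ` {e..1} \<in> sets ?\<nu>" by simp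
  have "{e..1} \<inter> spike -` (spike ` {e..1}) = {e..1}" by auto
  then show "0 < emeasure ?\<nu> (spike ` {e..1})"
    using emeasure_law[OF spike_borel sE im] e by simp
  show "finite_measure ?\<nu>" by (intro finite_measure_law[OF spike_borel] emeasure_bounded_finite) simp_all
  have "\<forall>\<^sub>F r in at_right 0. 0 < r \<and> r < (1 - e) / 2"
    using e by (auto simp: eventually_at_right_field intro: exI[of _ "(1-e)/2"])
  then show "\<forall>\<^sub>F r in at_right 0.
      (\<forall>x\<in>spike ` {e..1}. ennreal (e\<^sup>2 * r) \<le> emeasure ?\<nu> (mball_of osc_line x r)) \<and>
      (\<forall>x\<in>UNIV. emeasure ?\<nu> (mball_of osc_line x r) \<le> ennreal (4 / spike e * r))"
  proof eventually_elim
    case (elim r)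
    have "ennreal (e\<^sup>2 * r) \<le> emeasure ?\<nu> (mball_of osc_line (spike x) r)" if x: "x \<in> {e..1}" for x
    proof -
      define h where "h = e\<^sup>2 * r"
      have "e\<^sup>2 \<le> 1" using e by (simp add: power_le_one)
      then have h: "0 < h" "h \<le> r" using e elim by (auto simp: h_def mult_left_le_one_le)
      have "ennreal h \<le> emeasure lborel ({e..1} \<inter> {x-h<..<x+h})"
        using x h elim by (intro lborel_Icc_inter_ball_ge) auto
      also have "\<dots> \<le> emeasure ?\<nu> (mball_of osc_line (spike x) r)"
        unfolding ball
      proof (rule emeasure_mono)
        show "{e..1} \<inter> {x-h<..<x+h} \<subseteq> {y \<in> {e..1}. osc_dist (spike x) (spike y) < r}"
        proof
          fix y assume y: "y \<in> {e..1} \<inter> {x-h<..<x+h}"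
          then have "\<bar>x - y\<bar> < h" by auto
          then have "\<bar>x - y\<bar> / e\<^sup>2 < r"
            using e by (simp add: h_def pos_divide_less_eq mult.commute)
          then have "osc_dist (spike x) (spike y) < r"
            using spike_bilipschitz(2)[of e x y] x y e by (simp add: osc_dist_spike)
          then show "y \<in> {y \<in> {e..1}. osc_dist (spike x) (spike y) < r}" using y by auto
        qed
        show "{y \<in> {e..1}. osc_dist (spike x) (spike y) < r} \<in> sets lborel"
          using law_mball_vimage_borel[OF spike_borel sE] by simp
      qed
      finally show ?thesis by (simp add: h_def)
    qed
    \<comment> \<open>The centre need not be in the support; any support point of the ball serves as a new centre,
       at the price of doubling the radius.\<close>
    moreover have "emeasure ?\<nu> (mball_of osc_line x r) \<le> ennreal (4 / spike e * r)" for x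
    proof (cases "\<exists>y0\<in>{e..1}. osc_dist x (spike y0) < r")
      case True
      then obtain y0 where y0: "y0 \<in> {e..1}" "osc_dist x (spike y0) < r" by auto
      let ?h = "2 * r / spike e"
      have "emeasure lborel {y \<in> {e..1}. osc_dist x (spike y) < r} \<le> ennreal (2 * ?h)"
      proof (rule lborel_subset_Icc_le)
        show "{y \<in> {e..1}. osc_dist x (spike y) < r} \<subseteq> {y0 - ?h..y0 + ?h}"
        proof
          fix y assume y: "y \<in> {y \<in> {e..1}. osc_dist x (spike y) < r}"
          have "spike e * \<bar>y0 - y\<bar> \<le> \<bar>spike y0 - spike y\<bar>"
            using spike_bilipschitz(1)[of e y0 y] e y y0 by auto
          also have "\<dots> \<le> 2 * r"
            using y y0 osc_dist_ge[of x "spike y"] osc_dist_ge[of x "spike y0"] by auto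
          finally have "\<bar>y0 - y\<bar> \<le> ?h"
            by (simp add: pos_le_divide_eq mult.commute)
          then show "y \<in> {y0 - ?h..y0 + ?h}" by auto
        qed
      qed (use elim in \<open>simp add: less_imp_le\<close>)
      then show ?thesis by (simp add: ball)
    next
      case False
      then have "{y \<in> {e..1}. osc_dist x (spike y) < r} = {}" by auto
      then show ?thesis by (simp only: ball) simp
    qed
    ultimately show ?case by blast
  qed
qed (use e in auto)

lemma with_atom_tv_tendsto:
  assumes "F \<in> sets borel" "emeasure lborel F < \<infinity>"
    and "\<And>n. E n \<in> sets borel" "\<And>n. emeasure lborel (E n) < \<infinity>"
    and "\<And>n. emeasure lborel (E n - F) \<le> ennreal (e n)" "\<And>n. emeasure lborel (F - E n) \<le> ennreal (e n)"
    and "\<And>n. 0 \<le> e n" "e \<longlonglongrightarrow> 0"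
  shows "(\<lambda>n. tv_dist osc_line (with_atom (E n)) (with_atom F)) \<longlonglongrightarrow> 0"
  unfolding with_atom_def by (rule tv_dist_law_tendsto[OF cap_borel assms])

section \<open>Failure of semi-continuity\<close>

lemma tv_small_atom:
  defines "e \<equiv> \<lambda>n. 1 / (real n + 2)"
  shows "(\<lambda>n. tv_dist osc_line (with_atom ({0..1 - e n} \<union> {2..2 + e n})) (with_atom {0..1})) \<longlonglongrightarrow> 0"
proof (rule with_atom_tv_tendsto[where e="\<lambda>n. 2 * e n"])
  fix n
  have e: "0 < e n" "e n < 1" by (auto simp: e_def field_simps)
  show "emeasure lborel ({0..1 - e n} \<union> {2..2 + e n}) < \<infinity>"
    by (rule emeasure_bounded_finite) (simp add: bounded_Un)
  show "emeasure lborel (({0..1 - e n} \<union> {2..2 + e n}) - {0..1}) \<le> ennreal (2 * e n)"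
    by (rule lborel_subset_Icc_le[of _ 2]) (use e in auto)
  show "emeasure lborel ({0..1} - ({0..1 - e n} \<union> {2..2 + e n})) \<le> ennreal (2 * e n)"
    by (rule lborel_subset_Icc_le[of _ 1]) (use e in auto)
  show "0 \<le> 2 * e n" using e by simp
next
  show "(\<lambda>n. 2 * e n) \<longlonglongrightarrow> 0" unfolding e_def by real_asymp
qed auto

lemma tv_osc_extended:
  defines "e \<equiv> \<lambda>n. 1 / (real n + 2)"
  shows "(\<lambda>n. tv_dist osc_line (with_atom ({-1..e n} \<union> {2..3})) (with_atom ({-1..0} \<union> {2..3}))) \<longlonglongrightarrow> 0"
proof (rule with_atom_tv_tendsto[where e="\<lambda>n. 2 * e n"])
  fix n
  have e: "0 < e n" "e n < 1" by (auto simp: e_def field_simps)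
  show "emeasure lborel ({-1..e n} \<union> {2..3}) < \<infinity>"
    by (rule emeasure_bounded_finite) (simp add: bounded_Un)
  show "emeasure lborel (({-1..e n} \<union> {2..3}) - ({-1..0} \<union> {2..3})) \<le> ennreal (2 * e n)"
    by (rule lborel_subset_Icc_le[of _ 0]) (use e in auto)
  show "emeasure lborel (({-1..0} \<union> {2..3}) - ({-1..e n} \<union> {2..3})) \<le> ennreal (2 * e n)"
    by (rule lborel_subset_Icc_le[of _ 0]) (use e in auto)
  show "0 \<le> 2 * e n" using e by simp
next
  show "(\<lambda>n. 2 * e n) \<longlonglongrightarrow> 0" unfolding e_def by real_asymp
  show "emeasure lborel ({-1..0} \<union> {2..3::real}) < \<infinity>"
    by (rule emeasure_bounded_finite) (simp add: bounded_Un)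
qed auto

lemma tv_spike_truncated:
  defines "e \<equiv> \<lambda>n. 1 / (real n + 2)"
  shows "(\<lambda>n. tv_dist osc_line (law spike {e n..1}) (law spike {0<..1})) \<longlonglongrightarrow> 0"
proof (rule tv_dist_law_tendsto[where e="\<lambda>n. 2 * e n"])
  fix n
  have e: "0 < e n" "e n < 1" by (auto simp: e_def field_simps)
  show "emeasure lborel {e n..1} < \<infinity>"
    by (rule emeasure_bounded_finite) simp
  show "emeasure lborel ({e n..1} - {0<..1}) \<le> ennreal (2 * e n)"
    by (rule lborel_subset_Icc_le[of _ 0]) (use e in auto)
  show "emeasure lborel ({0<..1} - {e n..1}) \<le> ennreal (2 * e n)"
    by (rule lborel_subset_Icc_le[of _ 0]) (use e in auto)
  show "0 \<le> 2 * e n" using e by simp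
next
  show "(\<lambda>n. 2 * e n) \<longlonglongrightarrow> 0" unfolding e_def by real_asymp
qed auto

theorem theorem3p13:
  shows "\<forall>D \<in> {dim_C, dim_MC}.
    (\<exists>(X :: real metric) (\<nu>s :: nat \<Rightarrow> real measure) (\<nu> :: real measure) (ds :: nat \<Rightarrow> ereal) (d :: ereal).
        (\<forall>n. \<nu>s n \<in> borel_measures X \<and> D X (\<nu>s n) = Some (ds n)) \<and>
        \<nu> \<in> borel_measures X \<and> D X \<nu> = Some d \<and>
        (\<lambda>n. tv_dist X (\<nu>s n) \<nu>) \<longlonglongrightarrow> 0 \<and>
        limsup ds > d) \<and>
    (\<exists>(X :: real metric) (\<nu>s :: nat \<Rightarrow> real measure) (\<nu> :: real measure) (ds :: nat \<Rightarrow> ereal) (d :: ereal).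
        (\<forall>n. \<nu>s n \<in> borel_measures X \<and> D X (\<nu>s n) = Some (ds n)) \<and>
        \<nu> \<in> borel_measures X \<and> D X \<nu> = Some d \<and>
        (\<lambda>n. tv_dist X (\<nu>s n) \<nu>) \<longlonglongrightarrow> 0 \<and>
        liminf ds < d)"
proof (intro ballI)
  fix D :: "real metric \<Rightarrow> real measure \<Rightarrow> ereal option"
  assume D: "D \<in> {dim_C, dim_MC}"
  define e where "e n = 1 / (real n + 2)" for n :: nat
  have e: "0 < e n" "e n < 1" for n by (auto simp: e_def field_simps)

  have lower: "D osc_line (with_atom ({0..1 - e n} \<union> {2..2 + e n})) = Some 0" for n
    using D dim_C_small_atom[OF e] dim_MC_small_atom[OF e] by auto
  have lower_limit: "D osc_line (with_atom {0..1}) = Some 1"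
    using D dim_C_unit dim_MC_unit by auto
  have lsc: "\<exists>(X :: real metric) \<nu>s \<nu> ds d.
        (\<forall>n. \<nu>s n \<in> borel_measures X \<and> D X (\<nu>s n) = Some (ds n)) \<and>
        \<nu> \<in> borel_measures X \<and> D X \<nu> = Some d \<and>
        (\<lambda>n. tv_dist X (\<nu>s n) \<nu>) \<longlonglongrightarrow> 0 \<and> liminf ds < d"
  proof (intro exI conjI allI)
    show "(\<lambda>n. tv_dist osc_line (with_atom ({0..1 - e n} \<union> {2..2 + e n})) (with_atom {0..1})) \<longlonglongrightarrow> 0"
      unfolding e_def by (rule tv_small_atom)
    show "liminf (\<lambda>n. 0 :: ereal) < 1" by (simp add: Liminf_const)
  qed (simp_all only: lower lower_limit with_atom_in_borel_measures)

  have usc: "\<exists>(X :: real metric) \<nu>s \<nu> ds d.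
        (\<forall>n. \<nu>s n \<in> borel_measures X \<and> D X (\<nu>s n) = Some (ds n)) \<and>
        \<nu> \<in> borel_measures X \<and> D X \<nu> = Some d \<and>
        (\<lambda>n. tv_dist X (\<nu>s n) \<nu>) \<longlonglongrightarrow> 0 \<and> limsup ds > d"
  proof (cases "D = dim_C")
    case True
    show ?thesis
      unfolding True
    proof (intro exI conjI allI)
      show "(\<lambda>n. tv_dist osc_line (law spike {e n..1}) (law spike {0<..1})) \<longlonglongrightarrow> 0"
        unfolding e_def by (rule tv_spike_truncated)
      show "0 < limsup (\<lambda>n. 1 :: ereal)" by (simp add: Limsup_const)
    qed (simp_all only: dim_C_spike dim_C_spike_truncated[OF e] law_in_borel_measures)
  next
    case False
    with D have D: "D = dim_MC" by simp
    have "\<exists>L\<ge>1. dim_MC osc_line (with_atom ({-1..e n} \<union> {2..3})) = Some L" for n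
      using e[of n] by (intro dim_MC_osc_extended) auto
    then obtain ds where ds: "\<And>n. 1 \<le> ds n"
        "\<And>n. dim_MC osc_line (with_atom ({-1..e n} \<union> {2..3})) = Some (ds n)"
      by metis
    have "1 \<le> limsup ds"
      using ds(1) by (intro le_Limsup) auto
    then have "0 < limsup ds" by (rule less_le_trans[rotated]) simp
    show ?thesis
      unfolding D
    proof (intro exI conjI allI)
      show "(\<lambda>n. tv_dist osc_line (with_atom ({-1..e n} \<union> {2..3})) (with_atom ({-1..0} \<union> {2..3}))) \<longlonglongrightarrow> 0"
        unfolding e_def by (rule tv_osc_extended)
      show "0 < limsup ds" by fact
      show "dim_MC osc_line (with_atom ({-1..e n} \<union> {2..3})) = Some (ds n)" for n by (rule ds(2))
      show "dim_MC osc_line (with_atom ({-1..0} \<union> {2..3})) = Some 0" by (rule dim_MC_osc)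
    qed (simp_all only: with_atom_in_borel_measures)
  qed
  from usc lsc show "(\<exists>(X :: real metric) (\<nu>s :: nat \<Rightarrow> real measure) (\<nu> :: real measure) (ds :: nat \<Rightarrow> ereal) (d :: ereal).
        (\<forall>n. \<nu>s n \<in> borel_measures X \<and> D X (\<nu>s n) = Some (ds n)) \<and>
        \<nu> \<in> borel_measures X \<and> D X \<nu> = Some d \<and>
        (\<lambda>n. tv_dist X (\<nu>s n) \<nu>) \<longlonglongrightarrow> 0 \<and>
        limsup ds > d) \<and>
    (\<exists>(X :: real metric) (\<nu>s :: nat \<Rightarrow> real measure) (\<nu> :: real measure) (ds :: nat \<Rightarrow> ereal) (d :: ereal).
        (\<forall>n. \<nu>s n \<in> borel_measures X \<and> D X (\<nu>s n) = Some (ds n)) \<and>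
        \<nu> \<in> borel_measures X \<and> D X \<nu> = Some d \<and>
        (\<lambda>n. tv_dist X (\<nu>s n) \<nu>) \<longlonglongrightarrow> 0 \<and>
        liminf ds < d)"
    by (rule conjI)
qed

end
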